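(* Let $I\subset\mathbb{R}$ be an interval, let $f:I\to\mathbb{R}$ be differentiable on the interior $I^{\circ}$ with $f'\in L[a,b]$, where $a,b\in I^{\circ}$, $a<b$. If $|f'|^{q}$ is quasi-convex on $[a,b]$ for some $q\ge 1$, then $$\left|\frac16\left[f(a)+4f\left(\frac{a+b}{2}\right)+f(b)\right]-\frac{1}{b-a}\int_a^b f(x)\,dx\right|\le (b-a)\,\frac{5}{36}\,\left(\sup\{|f'(a)|^q,|f'(b)|^q\}\right)^{1/q}.$$
   Context: A function $g:[a,b]\to\mathbb{R}$ is quasi-convex on $[a,b]$ if $g(tx+(1-t)y)\le\sup\{g(x),g(y)\}$ for all $x,y\in[a,b]$ and $t\in[0,1]$. $L[a,b]$ denotes the set of Lebesgue integrable functions on $[a,b]$. *)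

theory Defs
  imports "HOL-Analysis.Analysis"
begin

(* As for the library's convex_on, g is total and S is meant to be convex, so that
   the convex combination stays in S. *)
definition quasi_convex_on :: "real set \<Rightarrow> (real \<Rightarrow> real) \<Rightarrow> bool" where
  "quasi_convex_on S g \<longleftrightarrow>
     (\<forall>x\<in>S. \<forall>y\<in>S. \<forall>t\<in>{0..1}. g (t * x + (1 - t) * y) \<le> Sup {g x, g y})"

end

theory Submission
  imports Defs
begin

text \<open>
  Quasi-convexity bounds \<open>\<bar>f'\<bar>\<close> on \<open>[a, b]\<close> by its larger endpoint value \<open>M\<close>, so that \<open>f\<close> is
  \<open>M\<close>-Lipschitz there. The Simpson value is a Riemann sum: cut \<open>[a, b]\<close> at \<open>(5 * a + b) / 6\<close> and
  \<open>(a + 5 * b) / 6\<close> and take the tags \<open>a\<close>, \<open>(a + b) / 2\<close>, \<open>b\<close>. Ostrowski's inequality on the three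
  pieces adds up to the constant \<open>1/72 + 8/72 + 1/72 = 5/36\<close>.
\<close>

lemma has_integral_abs_diff:
  fixes m u v :: real
  assumes "u \<le> m" "m \<le> v"
  shows "((\<lambda>x. \<bar>m - x\<bar>) has_integral ((m - u)\<^sup>2 + (v - m)\<^sup>2) / 2) {u..v}"
proof -
  \<comment> \<open>The integrand has its kink at \<open>m\<close>. On either side of it the
    absolute value resolves to a linear function, with antiderivative
    \<open>- ((m - x)\<^sup>2 / 2)\<close> on the left and \<open>(x - m)\<^sup>2 / 2\<close> on the
    right.\<close>
  have "((\<lambda>x. m - x) has_integral - ((m - m)\<^sup>2 / 2) - - ((m - u)\<^sup>2 / 2)) {u..m}"
    by (rule fundamental_theorem_of_calculus[OF \<open>u \<le> m\<close>])
       (auto intro!: derivative_eq_intros simp: field_simps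
          simp flip: has_real_derivative_iff_has_vector_derivative)
  then have left: "((\<lambda>x. \<bar>m - x\<bar>) has_integral (m - u)\<^sup>2 / 2) {u..m}"
    by (subst has_integral_cong[where g = "\<lambda>x. m - x"]) auto
  have "((\<lambda>x. x - m) has_integral (v - m)\<^sup>2 / 2 - (m - m)\<^sup>2 / 2) {m..v}"
    by (rule fundamental_theorem_of_calculus[OF \<open>m \<le> v\<close>])
       (auto intro!: derivative_eq_intros
          simp flip: has_real_derivative_iff_has_vector_derivative)
  then have right: "((\<lambda>x. \<bar>m - x\<bar>) has_integral (v - m)\<^sup>2 / 2) {m..v}"
    by (subst has_integral_cong[where g = "\<lambda>x. x - m"]) auto
  show ?thesis
    using has_integral_combine[OF assms left right] by (simp add: add_divide_distrib)
qed

text \<open>The left-hand side is the absolute value of the integral of \<open>f m - f x\<close>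
  over \<open>{u..v}\<close>, and the Lipschitz condition bounds this integrand pointwise by
  \<open>M * \<bar>m - x\<bar>\<close>.\<close>

lemma ostrowski_inequality:
  fixes f :: "real \<Rightarrow> real"
  assumes lip: "M-lipschitz_on {u..v} f" and m: "u \<le> m" "m \<le> v"
  shows "\<bar>(v - u) * f m - integral {u..v} f\<bar> \<le> M * (((m - u)\<^sup>2 + (v - m)\<^sup>2) / 2)"
proof -
  have "f integrable_on {u..v}"
    using lipschitz_on_continuous_on[OF lip] by (rule integrable_continuous_real)
  then have *: "((\<lambda>x. f m - f x) has_integral (v - u) * f m - integral {u..v} f) {u..v}"
    using has_integral_diff[OF has_integral_const_real integrable_integral, of f u v "f m"] m
    by simp
  have bound: "((\<lambda>x. M * \<bar>m - x\<bar>) has_integral M * (((m - u)\<^sup>2 + (v - m)\<^sup>2) / 2)) {u..v}"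
    by (intro has_integral_mult_right has_integral_abs_diff m)
  have "norm (integral {u..v} (\<lambda>x. f m - f x)) \<le> integral {u..v} (\<lambda>x. M * \<bar>m - x\<bar>)"
    using * bound lipschitz_onD[OF lip] m
    by (intro integral_norm_bound_integral) (auto simp: dist_real_def)
  then show ?thesis
    unfolding integral_unique[OF *] integral_unique[OF bound] real_norm_def .
qed

lemma simpson_error_lipschitz:
  fixes f :: "real \<Rightarrow> real"
  assumes lip: "M-lipschitz_on {a..b} f" and "a < b"
  shows "\<bar>1 / 6 * (f a + 4 * f ((a + b) / 2) + f b) - 1 / (b - a) * integral {a..b} f\<bar>
    \<le> (b - a) * (5 / 36) * M"
proof -
  \<comment> \<open>The pieces \<open>{a..u}\<close>, \<open>{u..v}\<close>, \<open>{v..b}\<close>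
    have lengths 1/6, 4/6 and 1/6 of \<open>b - a\<close>, which are the Simpson weights of the tags
    \<open>a\<close>, \<open>c\<close>, \<open>b\<close>.\<close>
  define u v c where "u = (5 * a + b) / 6" and "v = (a + 5 * b) / 6" and "c = (a + b) / 2"
  have ord: "a \<le> u" "u \<le> c" "c \<le> v" "u \<le> v" "v \<le> b"
    using \<open>a < b\<close> by (simp_all add: u_def v_def c_def)
  have int: "f integrable_on {a..b}"
    using lipschitz_on_continuous_on[OF lip] by (rule integrable_continuous_real)
  have "f integrable_on {u..b}"
    using int by (rule integrable_subinterval_real) (use ord in auto)
  then have split: "integral {a..b} f = integral {a..u} f + integral {u..v} f + integral {v..b} f"
    using Henstock_Kurzweil_Integration.integral_combine[of a u b f]
      Henstock_Kurzweil_Integration.integral_combine[of u v b f] int ord by simp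
  have l: "M-lipschitz_on {a..u} f" "M-lipschitz_on {u..v} f" "M-lipschitz_on {v..b} f"
    using ord by (auto intro!: lipschitz_on_subset[OF lip])
  \<comment> \<open>The error is scaled by \<open>b - a\<close>, so that it splits into one
    Ostrowski difference per piece.\<close>
  let ?S = "(b - a) * (1 / 6 * (f a + 4 * f c + f b)) - integral {a..b} f"
  have "?S = ((u - a) * f a - integral {a..u} f) + ((v - u) * f c - integral {u..v} f)
      + ((b - v) * f b - integral {v..b} f)"
    unfolding split u_def v_def by (simp add: field_simps)
  also have "\<bar>\<dots>\<bar> \<le> M * (((a - a)\<^sup>2 + (u - a)\<^sup>2) / 2) + M * (((c - u)\<^sup>2 + (v - c)\<^sup>2) / 2)
      + M * (((b - v)\<^sup>2 + (b - b)\<^sup>2) / 2)"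
    using ostrowski_inequality[OF l(1), of a] ostrowski_inequality[OF l(2), of c]
      ostrowski_inequality[OF l(3), of b] ord by linarith
  \<comment> \<open>The tags lie at distance \<open>(b - a) / 6\<close> from the far end of each
    outer piece and \<open>(b - a) / 3\<close> from both ends of the middle one. This gives the
    shares 1/72, 1/9 and 1/72 of \<open>M * (b - a)\<^sup>2\<close>.\<close>
  also have "\<dots> = (b - a) * ((b - a) * (5 / 36) * M)"
    unfolding u_def v_def c_def by (simp add: field_simps power2_eq_square)
  finally have S: "\<bar>?S\<bar> \<le> (b - a) * ((b - a) * (5 / 36) * M)" .
  have "\<bar>?S\<bar> = (b - a) * \<bar>1 / 6 * (f a + 4 * f c + f b) - 1 / (b - a) * integral {a..b} f\<bar>"
    using \<open>a < b\<close> by (simp add: abs_mult_pos' right_diff_distrib)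
  then show ?thesis
    using S \<open>a < b\<close> unfolding c_def by simp
qed

lemma quasi_convex_on_Icc_le:
  fixes g :: "real \<Rightarrow> real"
  assumes "quasi_convex_on {a..b} g" and "x \<in> {a..b}"
  shows "g x \<le> Sup {g a, g b}"
proof (cases "a < b")
  case True
  \<comment> \<open>The weight is found by solving \<open>x = t * a + (1 - t) * b\<close> for
    \<open>t\<close>.\<close>
  define t where "t = (b - x) / (b - a)"
  have "t \<in> {0..1}" and "x = t * a + (1 - t) * b"
    using assms(2) True by (auto simp: t_def divide_simps) (simp add: algebra_simps)
  then show ?thesis
    using assms True unfolding quasi_convex_on_def by (metis atLeastAtMost_iff less_imp_le order_refl)
next
  case False
  then have "x = a" "x = b"
    using assms(2) by auto
  then show ?thesis by simp
qed

theorem corollary2: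
  fixes I :: "real set" and f :: "real \<Rightarrow> real" and a b q :: real
  assumes "is_interval I"
    and "f differentiable_on interior I"
    and "a \<in> interior I" and "b \<in> interior I" and "a < b"
    and "set_integrable lebesgue {a..b} (deriv f)"
    and "q \<ge> 1"
    and "quasi_convex_on {a..b} (\<lambda>x. \<bar>deriv f x\<bar> powr q)"
  shows "\<bar>1 / 6 * (f a + 4 * f ((a + b) / 2) + f b) - 1 / (b - a) * integral {a..b} f\<bar>
    \<le> (b - a) * (5 / 36) * (Sup {\<bar>deriv f a\<bar> powr q, \<bar>deriv f b\<bar> powr q}) powr (1 / q)"
proof (rule simpson_error_lipschitz[OF _ \<open>a < b\<close>])
  let ?M = "(Sup {\<bar>deriv f a\<bar> powr q, \<bar>deriv f b\<bar> powr q}) powr (1 / q)"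
  \<comment> \<open>Convexity puts all of \<open>{a..b}\<close> inside the open set
    \<open>interior I\<close>, so \<open>deriv f\<close> is a genuine two-sided derivative even at
    \<open>a\<close> and \<open>b\<close>.\<close>
  have "convex (interior I)"
    using assms(1) by (simp add: is_interval_convex convex_interior)
  then have sub: "{a..b} \<subseteq> interior I"
    using assms(3-5) closed_segment_subset by (metis closed_segment_eq_real_ivl less_imp_le)
  have der: "(f has_real_derivative deriv f x) (at x)" if "x \<in> {a..b}" for x
  proof -
    have "f differentiable at x"
      using assms(2) sub that
      by (meson differentiable_on_eq_differentiable_at open_interior subsetD)
    then show ?thesis
      by (simp add: DERIV_deriv_iff_real_differentiable)
  qed
  have bound: "\<bar>deriv f x\<bar> \<le> ?M" if "x \<in> {a..b}" for x
  proof -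
    \<comment> \<open>Taking q-th roots is monotone on nonnegative reals and turns the bound on
      \<open>\<bar>deriv f x\<bar> powr q\<close> into one on
      \<open>\<bar>deriv f x\<bar>\<close>.\<close>
    have "(\<bar>deriv f x\<bar> powr q) powr (1 / q) \<le> ?M"
      using quasi_convex_on_Icc_le[OF assms(8) that] \<open>q \<ge> 1\<close> by (intro powr_mono2) auto
    then show ?thesis
      using \<open>q \<ge> 1\<close> by (simp add: powr_powr)
  qed
  show "?M-lipschitz_on {a..b} f"
  proof (rule lipschitz_onI)
    fix x y assume "x \<in> {a..b}" "y \<in> {a..b}"
    \<comment> \<open>This is the mean value inequality on the convex set
      \<open>{a..b}\<close>.\<close>
    then have "norm (f x - f y) \<le> ?M * norm (x - y)"
      by (intro field_differentiable_bound[of "{a..b}" f "deriv f"])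
         (use bound in \<open>auto intro!: has_field_derivative_at_within[OF der]\<close>)
    then show "dist (f x) (f y) \<le> ?M * dist x y"
      by (simp add: dist_norm)
  qed simp
qed

end
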